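(* Let $G$ be a $2$-connected graph and $f\colon V(G)\to\{1,0,\hat0\}$ a colouring. Let $G'=(G-f^{-1}(1))-E(G[f^{-1}(0)])$, i.e. the graph obtained by deleting all vertices of colour $1$ and then all edges both of whose endpoints have colour $0$, and let $S$ be a minimum vertex cover of $G'$. Then $S\cup f^{-1}(1)$ is a minimum-size $f$-respecting simultaneous dominating set of $G$. In particular, a minimum $f$-respecting simultaneous dominating set of $G$ can be computed in polynomial time if a minimum vertex cover of $G'$ can be computed in polynomial time.
   Context: All graphs are finite, simple and undirected; a graph is $2$-connected if it has no cut vertex. For a connected graph $G$ and $S\subseteq V(G)$, a vertex $w$ is simultaneously dominated by $S$ if in every spanning tree $T$ of $G$, $w\in S$ or $w$ has a neighbour in $T$ belonging to $S$. For a colouring $f\colon V(G)\to\{1,0,\hat 0\}$, a set $S\subseteq V(G)$ is an $f$-respecting simultaneous dominating set of $G$ if $f^{-1}(1)\subseteq S$ and every vertex of $f^{-1}(\hat 0)$ is simultaneously dominated by $S$.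
   Formalization: The 2-connected graph G is required to be connected with at least two vertices, since for a single vertex of colour 0̂ the empty set is a minimum vertex cover of G' but does not dominate that vertex. *)

theory Defs
  imports "HOL-Computational_Algebra.Polynomial"
begin

section \<open>Finite simple undirected graphs\<close>

record 'a ugraph =
  verts :: "'a set"
  edges :: "'a set set"

definition simple_graph :: "'a ugraph \<Rightarrow> bool" where
  "simple_graph G \<longleftrightarrow> finite (verts G) \<and> (\<forall>e\<in>edges G. e \<subseteq> verts G \<and> card e = 2)"

definition adj_rel :: "'a ugraph \<Rightarrow> ('a \<times> 'a) set" where
  "adj_rel G = {(u, v). {u, v} \<in> edges G}"

definition connected_graph :: "'a ugraph \<Rightarrow> bool" where
  "connected_graph G \<longleftrightarrow>
     verts G \<noteq> {} \<and> (\<forall>u\<in>verts G. \<forall>v\<in>verts G. (u, v) \<in> (adj_rel G)\<^sup>*)"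

definition del_verts :: "'a ugraph \<Rightarrow> 'a set \<Rightarrow> 'a ugraph" where
  "del_verts G A = \<lparr>verts = verts G - A, edges = {e \<in> edges G. e \<inter> A = {}}\<rparr>"

definition del_edges :: "'a ugraph \<Rightarrow> 'a set set \<Rightarrow> 'a ugraph" where
  "del_edges G F = \<lparr>verts = verts G, edges = edges G - F\<rparr>"

definition induced_subgraph :: "'a ugraph \<Rightarrow> 'a set \<Rightarrow> 'a ugraph" where
  "induced_subgraph G A = \<lparr>verts = verts G \<inter> A, edges = {e \<in> edges G. e \<subseteq> A}\<rparr>"

definition cut_vertex :: "'a ugraph \<Rightarrow> 'a \<Rightarrow> bool" where
  "cut_vertex G v \<longleftrightarrow> v \<in> verts G \<and>
     (\<exists>x\<in>verts G - {v}. \<exists>y\<in>verts G - {v}.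
        (x, y) \<in> (adj_rel G)\<^sup>* \<and> (x, y) \<notin> (adj_rel (del_verts G {v}))\<^sup>*)"

text \<open>
  A single edge counts as 2-connected, a single vertex does not: a lone vertex can only be
  dominated by itself, whereas the empty set is a vertex cover of it.
\<close>
definition two_connected :: "'a ugraph \<Rightarrow> bool" where
  "two_connected G \<longleftrightarrow> simple_graph G \<and> connected_graph G \<and> card (verts G) \<ge> 2 \<and>
     (\<nexists>v. cut_vertex G v)"

definition cycle :: "'a ugraph \<Rightarrow> 'a list \<Rightarrow> bool" where
  "cycle G p \<longleftrightarrow> length p \<ge> 3 \<and> distinct p \<and>
     (\<forall>i < length p. {p ! i, p ! (Suc i mod length p)} \<in> edges G)"

definition tree_graph :: "'a ugraph \<Rightarrow> bool" where
  "tree_graph T \<longleftrightarrow> simple_graph T \<and> connected_graph T \<and> (\<nexists>p. cycle T p)"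

definition spanning_tree :: "'a ugraph \<Rightarrow> 'a ugraph \<Rightarrow> bool" where
  "spanning_tree G T \<longleftrightarrow> tree_graph T \<and> verts T = verts G \<and> edges T \<subseteq> edges G"

definition vertex_cover :: "'a ugraph \<Rightarrow> 'a set \<Rightarrow> bool" where
  "vertex_cover G S \<longleftrightarrow> S \<subseteq> verts G \<and> (\<forall>e\<in>edges G. e \<inter> S \<noteq> {})"

definition minimum_vertex_cover :: "'a ugraph \<Rightarrow> 'a set \<Rightarrow> bool" where
  "minimum_vertex_cover G S \<longleftrightarrow> vertex_cover G S \<and> (\<forall>S'. vertex_cover G S' \<longrightarrow> card S \<le> card S')"


section \<open>Simultaneous domination\<close>

definition simultaneously_dominated :: "'a ugraph \<Rightarrow> 'a set \<Rightarrow> 'a \<Rightarrow> bool" where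
  "simultaneously_dominated G S w \<longleftrightarrow>
     (\<forall>T. spanning_tree G T \<longrightarrow> w \<in> S \<or> (\<exists>u\<in>S. {w, u} \<in> edges T))"

datatype colour = One | Zero | ZeroHat

definition colour_class :: "'a ugraph \<Rightarrow> ('a \<Rightarrow> colour) \<Rightarrow> colour \<Rightarrow> 'a set" where
  "colour_class G f c = {v \<in> verts G. f v = c}"

definition respecting_sds :: "'a ugraph \<Rightarrow> ('a \<Rightarrow> colour) \<Rightarrow> 'a set \<Rightarrow> bool" where
  "respecting_sds G f S \<longleftrightarrow> S \<subseteq> verts G \<and> colour_class G f One \<subseteq> S \<and>
     (\<forall>w\<in>colour_class G f ZeroHat. simultaneously_dominated G S w)"

definition minimum_respecting_sds :: "'a ugraph \<Rightarrow> ('a \<Rightarrow> colour) \<Rightarrow> 'a set \<Rightarrow> bool" where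
  "minimum_respecting_sds G f S \<longleftrightarrow>
     respecting_sds G f S \<and> (\<forall>S'. respecting_sds G f S' \<longrightarrow> card S \<le> card S')"

definition reduced_graph :: "'a ugraph \<Rightarrow> ('a \<Rightarrow> colour) \<Rightarrow> 'a ugraph" where
  "reduced_graph G f =
     del_edges (del_verts G (colour_class G f One))
               (edges (induced_subgraph G (colour_class G f Zero)))"


section \<open>Polynomial time\<close>

text \<open>
  The machine model is the WHILE language of Jones (\<^emph>\<open>Computability and Complexity\<close>, 1997): imperative
  programs whose variables hold binary trees. Evaluating an expression is charged the total size
  of the values of all its subexpressions, so running time also bounds the space
  written, and polynomial time agrees with polynomial time on Turing machines.
\<close>

datatype tree = Leaf | Node tree tree

primrec tree_size :: "tree \<Rightarrow> nat" where
  "tree_size Leaf = 1"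
| "tree_size (Node a b) = 1 + tree_size a + tree_size b"

primrec left :: "tree \<Rightarrow> tree" where
  "left Leaf = Leaf"
| "left (Node a b) = a"

primrec right :: "tree \<Rightarrow> tree" where
  "right Leaf = Leaf"
| "right (Node a b) = b"

type_synonym store = "nat \<Rightarrow> tree"

datatype exp = Var nat | NilE | ConsE exp exp | Hd exp | Tl exp | Eq exp exp

primrec eval_exp :: "exp \<Rightarrow> store \<Rightarrow> tree" where
  "eval_exp (Var x) s = s x"
| "eval_exp NilE s = Leaf"
| "eval_exp (ConsE a b) s = Node (eval_exp a s) (eval_exp b s)"
| "eval_exp (Hd a) s = left (eval_exp a s)"
| "eval_exp (Tl a) s = right (eval_exp a s)"
| "eval_exp (Eq a b) s = (if eval_exp a s = eval_exp b s then Node Leaf Leaf else Leaf)"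

primrec exp_cost :: "exp \<Rightarrow> store \<Rightarrow> nat" where
  "exp_cost (Var x) s = tree_size (s x)"
| "exp_cost NilE s = 1"
| "exp_cost (ConsE a b) s = exp_cost a s + exp_cost b s + tree_size (eval_exp (ConsE a b) s)"
| "exp_cost (Hd a) s = exp_cost a s + tree_size (eval_exp (Hd a) s)"
| "exp_cost (Tl a) s = exp_cost a s + tree_size (eval_exp (Tl a) s)"
| "exp_cost (Eq a b) s = exp_cost a s + exp_cost b s + tree_size (eval_exp (Eq a b) s)"

datatype com = Assign nat exp | Seq com com | Cond exp com com | While exp com

text \<open>\<open>exec c s t s'\<close>: started in store \<open>s\<close>, \<open>c\<close> halts in store \<open>s'\<close> at total cost \<open>t\<close>.
  A test succeeds iff its value is not \<^const>\<open>Leaf\<close>.\<close>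
inductive exec :: "com \<Rightarrow> store \<Rightarrow> nat \<Rightarrow> store \<Rightarrow> bool" where
  Assign: "exec (Assign x a) s (exp_cost a s) (s(x := eval_exp a s))"
| Seq: "exec c s t s' \<Longrightarrow> exec d s' u s'' \<Longrightarrow> exec (Seq c d) s (t + u) s''"
| CondTrue: "eval_exp b s \<noteq> Leaf \<Longrightarrow> exec c s t s' \<Longrightarrow> exec (Cond b c d) s (exp_cost b s + t) s'"
| CondFalse: "eval_exp b s = Leaf \<Longrightarrow> exec d s t s' \<Longrightarrow> exec (Cond b c d) s (exp_cost b s + t) s'"
| WhileFalse: "eval_exp b s = Leaf \<Longrightarrow> exec (While b c) s (exp_cost b s) s"
| WhileTrue: "eval_exp b s \<noteq> Leaf \<Longrightarrow> exec c s t s' \<Longrightarrow> exec (While b c) s' u s'' \<Longrightarrow>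
    exec (While b c) s (exp_cost b s + t + u) s''"

definition init_store :: "tree \<Rightarrow> store" where
  "init_store x = (\<lambda>_. Leaf)(0 := x)"

text \<open>
  Search problems: one program, with one polynomial bound, maps every encoding of every instance
  to an encoding of some solution. Input and output are held in variable \<open>0\<close>.
\<close>
definition poly_time_solvable ::
  "'i set \<Rightarrow> ('i \<Rightarrow> tree \<Rightarrow> bool) \<Rightarrow> ('i \<Rightarrow> 'o \<Rightarrow> bool) \<Rightarrow> ('o \<Rightarrow> tree \<Rightarrow> bool) \<Rightarrow> bool" where
  "poly_time_solvable I encodes_in solution encodes_out \<longleftrightarrow>
     (\<exists>(c::com) (p::nat poly). \<forall>i\<in>I. \<forall>x. encodes_in i x \<longrightarrow>
        (\<exists>t s'. exec c (init_store x) t s' \<and> t \<le> poly p (tree_size x) \<and>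
                (\<exists>z. solution i z \<and> encodes_out z (s' 0))))"


section \<open>Encodings\<close>

text \<open>Binary notation, least significant bit first.\<close>
fun enc_nat :: "nat \<Rightarrow> tree" where
  "enc_nat n = (if n = 0 then Leaf
                else Node (if odd n then Node Leaf Leaf else Leaf) (enc_nat (n div 2)))"

declare enc_nat.simps [simp del]

definition enc_list :: "('b \<Rightarrow> tree) \<Rightarrow> 'b list \<Rightarrow> tree" where
  "enc_list enc xs = foldr (\<lambda>x. Node (enc x)) xs Leaf"

primrec enc_colour :: "colour \<Rightarrow> tree" where
  "enc_colour One = Leaf"
| "enc_colour Zero = Node Leaf Leaf"
| "enc_colour ZeroHat = Node Leaf (Node Leaf Leaf)"

definition encodes_set :: "nat set \<Rightarrow> tree \<Rightarrow> bool" where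
  "encodes_set S x \<longleftrightarrow> (\<exists>vs. distinct vs \<and> set vs = S \<and> x = enc_list enc_nat vs)"

text \<open>Every edge is listed exactly once, in either orientation.\<close>
definition encodes_edges :: "nat set set \<Rightarrow> tree \<Rightarrow> bool" where
  "encodes_edges E x \<longleftrightarrow>
     (\<exists>es. distinct (map (\<lambda>(u, v). {u, v}) es) \<and> set (map (\<lambda>(u, v). {u, v}) es) = E \<and>
           x = enc_list (\<lambda>(u, v). Node (enc_nat u) (enc_nat v)) es)"

definition encodes_graph :: "nat ugraph \<Rightarrow> tree \<Rightarrow> bool" where
  "encodes_graph G x \<longleftrightarrow>
     (\<exists>a b. x = Node a b \<and> encodes_set (verts G) a \<and> encodes_edges (edges G) b)"

definition encodes_coloured_graph :: "nat ugraph \<times> (nat \<Rightarrow> colour) \<Rightarrow> tree \<Rightarrow> bool" where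
  "encodes_coloured_graph = (\<lambda>(G, f) x.
     \<exists>vs b. x = Node (enc_list (\<lambda>v. Node (enc_nat v) (enc_colour (f v))) vs) b \<and>
            distinct vs \<and> set vs = verts G \<and> encodes_edges (edges G) b)"

end

(* If w and u are adjacent in a 2-connected graph, then G - w is connected, so some spanning tree
   has w as a leaf hanging from u. Hence w is simultaneously dominated by S iff w is in S or all
   neighbours of w are in S. The domination constraints therefore say that every edge with an
   endpoint of colour 0-hat is covered, and the edges not already covered by colour-1 vertices are
   exactly those of the reduced graph.

   For the complexity claim, a WHILE program filters the vertex and edge lists into an encoding of
   the reduced graph, parks the list of colour-1 vertices in a variable that the vertex cover
   program does not touch, runs that program, and appends the parked list to its output. *)
theory Submission
  imports Defs
begin

section \<open>Domination in 2-connected graphs\<close>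

text \<open>The map from \<open>S\<close> to \<open>S - colour_class G f One\<close> is a bijection
  from the respecting sets onto the vertex covers of \<open>reduced_graph G f\<close>. It lowers
  every cardinality by the same number, so minimum corresponds to minimum. On the machine side the
  vertex cover program is a black box whose guarantee concerns only runs from
  \<open>init_store y\<close>. Hence the reduction must erase its working variables, and a frame
  lemma must carry the run over to a store that also holds the parked list. The size of the
  program's output is known only through its running time. Evaluations are charged by the sizes of
  values, so counting steps is not enough: loop invariants must bound the data as well. The loops
  that build lists move entries from one variable to another, so a sum of two sizes never grows and
  one constant \<open>K\<close> bounds every evaluation. Prepending reverses lists, which is
  harmless because the encodings leave the order of vertices and edges free.\<close>

lemma simple_graph_edgeE:
  assumes "simple_graph G" "e \<in> edges G"
  obtains u v where "e = {u, v}" "u \<noteq> v" "u \<in> verts G" "v \<in> verts G"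
proof -
  have "card e = 2" "e \<subseteq> verts G"
    using assms by (auto simp: simple_graph_def)
  then show thesis
    using that by (auto simp: card_2_iff)
qed

lemma simple_graph_edge_verts:
  assumes "simple_graph G" "{u, v} \<in> edges G"
  shows "u \<in> verts G" "v \<in> verts G" "u \<noteq> v"
  using assms by (auto simp: simple_graph_def)

lemma simple_graph_finite_edges:
  assumes "simple_graph G"
  shows "finite (edges G)"
  by (rule finite_subset[of _ "Pow (verts G)"]) (use assms in \<open>auto simp: simple_graph_def\<close>)

lemma adj_rel_sym: "(u, v) \<in> adj_rel G \<longleftrightarrow> (v, u) \<in> adj_rel G"
  by (simp add: adj_rel_def insert_commute[of u])

lemma adj_rel_rtrancl_sym: "(u, v) \<in> (adj_rel G)\<^sup>* \<Longrightarrow> (v, u) \<in> (adj_rel G)\<^sup>*"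
proof -
  have "sym (adj_rel G)"
    by (rule symI) (simp add: adj_rel_sym)
  then show "(u, v) \<in> (adj_rel G)\<^sup>* \<Longrightarrow> (v, u) \<in> (adj_rel G)\<^sup>*"
    using sym_rtrancl symD by metis
qed

text \<open>Each edge only has to be simulated by a walk in \<open>H\<close>; this covers the
  rerouting of a deleted edge, where the edge sets are not included in one another.\<close>

lemma adj_rel_rtrancl_mono:
  assumes "\<And>u v. {u, v} \<in> edges G \<Longrightarrow> (u, v) \<in> (adj_rel H)\<^sup>*"
  shows "(adj_rel G)\<^sup>* \<subseteq> (adj_rel H)\<^sup>*"
proof -
  have "adj_rel G \<subseteq> (adj_rel H)\<^sup>*"
    using assms by (auto simp: adj_rel_def)
  then show ?thesis
    by (metis rtrancl_idemp rtrancl_mono)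
qed

text \<open>The rest of the cycle is a path joining the ends of the deleted edge, so every walk
  through that edge can be rerouted.\<close>

lemma connected_del_cycle_edge:
  assumes conn: "connected_graph G" and cyc: "cycle G p"
  shows "connected_graph (del_edges G {{p ! (length p - 1), p ! 0}})"
proof -
  let ?n = "length p" and ?e = "{p ! (length p - 1), p ! 0}"
  let ?H = "del_edges G {?e}"
  have n: "?n \<ge> 3" and pos: "0 < ?n" and dist: "distinct p"
    and edge: "\<And>i. i < ?n \<Longrightarrow> {p ! i, p ! (Suc i mod ?n)} \<in> edges G"
    using cyc by (auto simp: cycle_def)
  have path: "(p ! 0, p ! i) \<in> (adj_rel ?H)\<^sup>*" if "i < ?n" for i
    using that
  proof (induction i)
    case (Suc i)
    have ne: "{p ! i, p ! Suc i} \<noteq> ?e"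
    proof
      assume "{p ! i, p ! Suc i} = ?e"
      then have "p ! Suc i = p ! 0 \<or> p ! i = p ! 0 \<and> p ! Suc i = p ! (?n - 1)"
        by (auto simp: doubleton_eq_iff)
      \<comment> \<open>By distinctness, meeting the closing edge again would force a cycle of
        length 2; this is where length at least 3 enters.\<close>
      then have "i = 0 \<and> Suc i = ?n - 1"
        using Suc.prems n pos nth_eq_iff_index_eq[OF dist, of "Suc i" 0]
          nth_eq_iff_index_eq[OF dist, of i 0] nth_eq_iff_index_eq[OF dist, of "Suc i" "?n - 1"]
        by auto
      with n show False
        by linarith
    qed
    have "{p ! i, p ! Suc i} \<in> edges G"
      using edge[of i] Suc.prems by simp
    with ne have "(p ! i, p ! Suc i) \<in> adj_rel ?H"
      by (simp add: adj_rel_def del_edges_def)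
    with Suc show ?case
      by (meson Suc_lessD rtrancl.rtrancl_into_rtrancl)
  qed auto
  have "(u, v) \<in> (adj_rel ?H)\<^sup>*" if "{u, v} \<in> edges G" for u v
  proof (cases "{u, v} = ?e")
    case True
    then show ?thesis
      using path[of "?n - 1"] n
      by (auto simp: doubleton_eq_iff intro: adj_rel_rtrancl_sym)
  next
    case False
    with that show ?thesis
      by (auto simp: adj_rel_def del_edges_def)
  qed
  then have "(adj_rel G)\<^sup>* \<subseteq> (adj_rel ?H)\<^sup>*"
    by (rule adj_rel_rtrancl_mono)
  with conn show ?thesis
    by (auto simp: connected_graph_def del_edges_def)
qed

text \<open>The tree is a connected edge set of minimum size: an edge on a cycle could be dropped.\<close>
lemma spanning_tree_within:
  assumes simple: "simple_graph G" and "E0 \<subseteq> edges G"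
    and "connected_graph \<lparr>verts = verts G, edges = E0\<rparr>"
  obtains T where "spanning_tree G T" "edges T \<subseteq> E0"
proof -
  define ok where "ok = (\<lambda>E. E \<subseteq> E0 \<and> connected_graph \<lparr>verts = verts G, edges = E\<rparr>)"
  have "ok E0"
    using assms by (simp add: ok_def)
  then obtain E where E: "ok E" and min: "\<And>F. ok F \<Longrightarrow> card E \<le> card F"
    using ex_has_least_nat[of ok E0 card] by blast
  let ?T = "\<lparr>verts = verts G, edges = E\<rparr>"
  have sub: "E \<subseteq> edges G"
    using E assms(2) by (auto simp: ok_def)
  have fin: "finite E"
    using simple_graph_finite_edges[OF simple] sub finite_subset by blast
  have "\<not> cycle ?T p" for p
  proof
    assume cyc: "cycle ?T p"
    let ?e = "{p ! (length p - 1), p ! 0}"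
    have "length p - 1 < length p"
      using cyc by (auto simp: cycle_def)
    \<comment> \<open>The cycle condition at the last index, where the successor wraps around to
      0.\<close>
    then have "{p ! (length p - 1), p ! (Suc (length p - 1) mod length p)} \<in> E"
      using cyc unfolding cycle_def ugraph.select_convs by blast
    moreover have "Suc (length p - 1) = length p"
      using \<open>length p - 1 < length p\<close> by linarith
    ultimately have "?e \<in> E"
      by simp
    moreover have "ok (E - {?e})"
      using connected_del_cycle_edge[OF _ cyc] E by (auto simp: ok_def del_edges_def)
    ultimately show False
      using min[of "E - {?e}"] fin by (metis card_Diff1_less leD)
  qed
  then have "tree_graph ?T"
    using E simple sub by (auto simp: tree_graph_def simple_graph_def ok_def)
  then have "spanning_tree G ?T"
    using sub by (simp add: spanning_tree_def)
  then show thesis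
    using that E by (auto simp: ok_def)
qed

section \<open>Domination and leaves of spanning trees\<close>

lemma two_connected_leaf_spanning_tree:
  assumes G: "two_connected G" and wu: "{w, u} \<in> edges G"
  obtains T where "spanning_tree G T" "\<And>v. {w, v} \<in> edges T \<Longrightarrow> v = u"
proof -
  let ?G' = "del_verts G {w}"
  \<comment> \<open>The only edge of \<open>?E\<close> at \<open>w\<close> is \<open>{w, u}\<close>,
    so any spanning tree inside \<open>?E\<close> attaches \<open>w\<close> to \<open>u\<close>
    alone.\<close>
  let ?E = "insert {w, u} (edges ?G')"
  let ?H = "\<lparr>verts = verts G, edges = ?E\<rparr>"
  have simple: "simple_graph G" and conn: "connected_graph G" and cut: "\<not> cut_vertex G w"
    using G by (auto simp: two_connected_def)
  note wu' = simple_graph_edge_verts[OF simple wu]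
  have "(adj_rel ?G')\<^sup>* \<subseteq> (adj_rel ?H)\<^sup>*"
    by (rule rtrancl_mono) (auto simp: adj_rel_def)
  \<comment> \<open>A cut vertex separates two vertices that are joined in \<open>G\<close>. Since
    \<open>G\<close> is connected, its absence joins \<open>u\<close> to every other vertex of
    \<open>G - w\<close>.\<close>
  moreover have "(u, x) \<in> (adj_rel ?G')\<^sup>*" if "x \<in> verts G" "x \<noteq> w" for x
    using cut conn that wu' by (auto simp: cut_vertex_def connected_graph_def)
  moreover have "(u, w) \<in> (adj_rel ?H)\<^sup>*"
    by (auto simp: adj_rel_def insert_commute)
  ultimately have reach: "(u, x) \<in> (adj_rel ?H)\<^sup>*" if "x \<in> verts G" for x
    using that by (cases "x = w") auto
  have "(x, y) \<in> (adj_rel ?H)\<^sup>*" if "x \<in> verts G" "y \<in> verts G" for x y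
    using adj_rel_rtrancl_sym[OF reach[OF that(1)]] reach[OF that(2)] by (rule rtrancl_trans)
  then have "connected_graph ?H"
    using wu' by (auto simp: connected_graph_def)
  moreover have "?E \<subseteq> edges G"
    using wu by (auto simp: del_verts_def)
  ultimately obtain T where T: "spanning_tree G T" "edges T \<subseteq> ?E"
    using spanning_tree_within[OF simple] by blast
  have "v = u" if "{w, v} \<in> edges T" for v
  proof -
    have "{w, v} \<in> ?E"
      using that T(2) by blast
    then show ?thesis
      by (auto simp: del_verts_def doubleton_eq_iff)
  qed
  with T(1) show thesis
    by (rule that)
qed

lemma simultaneously_dominated_iff:
  assumes G: "two_connected G" and w: "w \<in> verts G"
  shows "simultaneously_dominated G S w \<longleftrightarrow> w \<in> S \<or> (\<forall>u. {w, u} \<in> edges G \<longrightarrow> u \<in> S)"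
proof
  assume dom: "simultaneously_dominated G S w"
  show "w \<in> S \<or> (\<forall>u. {w, u} \<in> edges G \<longrightarrow> u \<in> S)"
    using dom two_connected_leaf_spanning_tree[OF G]
    unfolding simultaneously_dominated_def by metis
next
  assume nbrs: "w \<in> S \<or> (\<forall>u. {w, u} \<in> edges G \<longrightarrow> u \<in> S)"
  \<comment> \<open>With a second vertex \<open>x\<close> available, the walk in a spanning tree
    from \<open>w\<close> to \<open>x\<close> starts with a tree edge at \<open>w\<close>. Its other
    end lies in \<open>S\<close> whenever all neighbours of \<open>w\<close> do.\<close>
  have "\<not> verts G \<subseteq> {w}"
    using G card_mono[of "{w}" "verts G"] by (auto simp: two_connected_def)
  then obtain x where x: "x \<in> verts G" "x \<noteq> w"
    by blast
  have "\<exists>u. {w, u} \<in> edges T" if "spanning_tree G T" for T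
  proof -
    have "(w, x) \<in> (adj_rel T)\<^sup>*"
      using that w x by (auto simp: spanning_tree_def tree_graph_def connected_graph_def)
    then obtain u where "(w, u) \<in> adj_rel T"
      using x(2) by (metis converse_rtranclE)
    then show ?thesis
      by (auto simp: adj_rel_def)
  qed
  then show "simultaneously_dominated G S w"
    using nbrs unfolding simultaneously_dominated_def spanning_tree_def by blast
qed

section \<open>The reduced graph and its vertex covers\<close>

lemma verts_reduced_graph: "verts (reduced_graph G f) = {v \<in> verts G. f v \<noteq> One}"
  by (auto simp: reduced_graph_def del_edges_def del_verts_def colour_class_def)

lemma edges_reduced_graph:
  assumes "simple_graph G"
  shows "{u, v} \<in> edges (reduced_graph G f) \<longleftrightarrow>
    {u, v} \<in> edges G \<and> f u \<noteq> One \<and> f v \<noteq> One \<and> (f u = ZeroHat \<or> f v = ZeroHat)"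
proof (cases "{u, v} \<in> edges G")
  case True
  then show ?thesis
    using simple_graph_edge_verts[OF assms True]
    by (cases "f u"; cases "f v")
      (auto simp: reduced_graph_def del_edges_def del_verts_def induced_subgraph_def colour_class_def)
qed (simp add: reduced_graph_def del_edges_def del_verts_def)

lemma respecting_sds_iff:
  assumes G: "two_connected G"
  shows "respecting_sds G f S \<longleftrightarrow> S \<subseteq> verts G \<and> colour_class G f One \<subseteq> S \<and>
    vertex_cover (reduced_graph G f) (S - colour_class G f One)"
    (is "_ \<longleftrightarrow> _ \<and> _ \<and> vertex_cover ?R (S - ?A)")
proof (cases "S \<subseteq> verts G \<and> ?A \<subseteq> S")
  case True
  have simple: "simple_graph G"
    using G by (simp add: two_connected_def)
  \<comment> \<open>Each edge is oriented so that \<open>w\<close> is an endpoint of colour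
    \<open>ZeroHat\<close>, matching the quantifier over dominated vertices.\<close>
  have edge: "e \<in> edges ?R \<longleftrightarrow> (\<exists>w u. e = {w, u} \<and> {w, u} \<in> edges G \<and> f w = ZeroHat \<and> f u \<noteq> One)"
    for e
  proof
    assume e: "e \<in> edges ?R"
    then have "e \<in> edges G"
      by (simp add: reduced_graph_def del_edges_def del_verts_def)
    then obtain u v where "e = {u, v}"
      using simple_graph_edgeE[OF simple] by blast
    with e show "\<exists>w u. e = {w, u} \<and> {w, u} \<in> edges G \<and> f w = ZeroHat \<and> f u \<noteq> One"
      using edges_reduced_graph[OF simple, of u v f] by (metis insert_commute)
  qed (use edges_reduced_graph[OF simple] in auto)
  have nbr_One: "u \<in> S" if "{w, u} \<in> edges G" "f u = One" for w u
    using True that simple_graph_edge_verts[OF simple] by (auto simp: colour_class_def)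
  have "respecting_sds G f S \<longleftrightarrow>
      (\<forall>w\<in>verts G. f w = ZeroHat \<longrightarrow> w \<in> S \<or> (\<forall>u. {w, u} \<in> edges G \<longrightarrow> u \<in> S))"
    using True simultaneously_dominated_iff[OF G]
    by (auto simp: respecting_sds_def colour_class_def)
  also have "\<dots> \<longleftrightarrow> (\<forall>w u. {w, u} \<in> edges G \<and> f w = ZeroHat \<and> f u \<noteq> One \<longrightarrow> w \<in> S \<or> u \<in> S)"
    using nbr_One simple_graph_edge_verts[OF simple] by blast
  also have "\<dots> \<longleftrightarrow> (\<forall>e\<in>edges ?R. e \<inter> (S - ?A) \<noteq> {})"
  proof -
    \<comment> \<open>Neither endpoint has colour \<open>One\<close>, so removing \<open>?A\<close>
      from \<open>S\<close> changes nothing at this edge.\<close>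
    have "{w, u} \<inter> (S - ?A) \<noteq> {} \<longleftrightarrow> w \<in> S \<or> u \<in> S"
      if "f w = ZeroHat" "f u \<noteq> One" for w u
      using that by (auto simp: colour_class_def)
    then show ?thesis
      unfolding Ball_def edge by metis
  qed
  also have "\<dots> \<longleftrightarrow> vertex_cover ?R (S - ?A)"
    using True by (auto simp: vertex_cover_def verts_reduced_graph colour_class_def)
  finally show ?thesis
    using True by blast
next
  case False
  then show ?thesis
    unfolding respecting_sds_def by meson
qed

lemma minimum_respecting_sds_reduced:
  assumes G: "two_connected G" and S: "minimum_vertex_cover (reduced_graph G f) S"
  shows "minimum_respecting_sds G f (S \<union> colour_class G f One)"
proof -
  let ?A = "colour_class G f One"
  have fin: "finite (verts G)"
    using G by (simp add: two_connected_def simple_graph_def)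
  have cover: "vertex_cover (reduced_graph G f) S"
    and min: "\<And>S'. vertex_cover (reduced_graph G f) S' \<Longrightarrow> card S \<le> card S'"
    using S by (auto simp: minimum_vertex_cover_def)
  have sub: "S \<subseteq> verts G - ?A"
    using cover by (auto simp: vertex_cover_def verts_reduced_graph colour_class_def)
  have A: "?A \<subseteq> verts G"
    by (auto simp: colour_class_def)
  have "S \<union> ?A - ?A = S"
    using sub by auto
  then have "respecting_sds G f (S \<union> ?A)"
    using cover sub A by (auto simp: respecting_sds_iff[OF G])
  moreover have "card (S \<union> ?A) \<le> card S'" if "respecting_sds G f S'" for S'
  proof -
    have S': "S' \<subseteq> verts G" "?A \<subseteq> S'" "vertex_cover (reduced_graph G f) (S' - ?A)"
      using that by (auto simp: respecting_sds_iff[OF G])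
    have finS': "finite S'" and finA: "finite ?A"
      using S'(1) A fin finite_subset by auto
    have "card (S \<union> ?A) \<le> card S + card ?A"
      by (rule card_Un_le)
    also have "\<dots> \<le> card (S' - ?A) + card ?A"
      using min[OF S'(3)] by simp
    also have "\<dots> = card S'"
      using S'(2) finS' finA by (metis card_Diff_subset card_mono le_add_diff_inverse2)
    finally show ?thesis .
  qed
  ultimately show ?thesis
    by (simp add: minimum_respecting_sds_def)
qed

section \<open>Running time of WHILE programs\<close>

primrec exp_vars :: "exp \<Rightarrow> nat set" where
  "exp_vars (Var x) = {x}"
| "exp_vars NilE = {}"
| "exp_vars (ConsE a b) = exp_vars a \<union> exp_vars b"
| "exp_vars (Hd a) = exp_vars a"
| "exp_vars (Tl a) = exp_vars a"
| "exp_vars (Eq a b) = exp_vars a \<union> exp_vars b"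

primrec com_vars :: "com \<Rightarrow> nat set" where
  "com_vars (Assign x a) = insert x (exp_vars a)"
| "com_vars (Seq c d) = com_vars c \<union> com_vars d"
| "com_vars (Cond b c d) = exp_vars b \<union> com_vars c \<union> com_vars d"
| "com_vars (While b c) = exp_vars b \<union> com_vars c"

lemma finite_exp_vars: "finite (exp_vars a)"
  by (induction a) auto

lemma finite_com_vars: "finite (com_vars c)"
  by (induction c) (auto simp: finite_exp_vars)

lemma eval_exp_cong: "(\<And>v. v \<in> exp_vars a \<Longrightarrow> s v = s' v) \<Longrightarrow> eval_exp a s = eval_exp a s'"
  by (induction a) auto

lemma exp_cost_cong: "(\<And>v. v \<in> exp_vars a \<Longrightarrow> s v = s' v) \<Longrightarrow> exp_cost a s = exp_cost a s'"
proof (induction a)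
  case (ConsE a b)
  then show ?case using eval_exp_cong[of "ConsE a b" s s'] by simp
next
  case (Hd a)
  then show ?case using eval_exp_cong[of a s s'] by simp
next
  case (Tl a)
  then show ?case using eval_exp_cong[of a s s'] by simp
next
  case (Eq a b)
  then show ?case using eval_exp_cong[of a s s'] eval_exp_cong[of b s s'] by simp
qed auto

text \<open>Execution reads and writes only variables of the program. This permits running an
  unknown program in a store that holds further data outside \<open>V\<close>, with the same
  cost.\<close>

lemma exec_frame:
  assumes "exec c s t s'" "com_vars c \<subseteq> V" "\<And>v. v \<in> V \<Longrightarrow> r v = s v"
  obtains r' where "exec c r t r'" "\<And>v. v \<in> V \<Longrightarrow> r' v = s' v" "\<And>v. v \<notin> V \<Longrightarrow> r' v = r v"
proof -
  have cong: "eval_exp a r = eval_exp a s" "exp_cost a r = exp_cost a s"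
    if "exp_vars a \<subseteq> V" "\<And>v. v \<in> V \<Longrightarrow> r v = s v" for a and r s :: store
    using that by (auto intro!: eval_exp_cong exp_cost_cong)
  have "\<exists>r'. exec c r t r' \<and> (\<forall>v\<in>V. r' v = s' v) \<and> (\<forall>v. v \<notin> V \<longrightarrow> r' v = r v)"
    using assms
  proof (induction arbitrary: r rule: exec.induct)
    case (Assign x a s)
    then have "eval_exp a r = eval_exp a s" "exp_cost a r = exp_cost a s"
      by (intro cong; simp)+
    then have "exec (Assign x a) r (exp_cost a s) (r(x := eval_exp a s))"
      using exec.Assign[of x a r] by simp
    moreover have "\<forall>v\<in>V. (r(x := eval_exp a s)) v = (s(x := eval_exp a s)) v"
      "\<forall>v. v \<notin> V \<longrightarrow> (r(x := eval_exp a s)) v = r v"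
      using Assign.prems by auto
    ultimately show ?case
      by blast
  next
    case (Seq c s t s' d u s'')
    from Seq.prems Seq.IH(1)[of r] obtain r'
      where r': "exec c r t r'" "\<forall>v\<in>V. r' v = s' v" "\<forall>v. v \<notin> V \<longrightarrow> r' v = r v"
      by auto
    from Seq.prems Seq.IH(2)[of r'] r' obtain r''
      where "exec d r' u r''" "\<forall>v\<in>V. r'' v = s'' v" "\<forall>v. v \<notin> V \<longrightarrow> r'' v = r' v"
      by auto
    with r' show ?case
      by (metis exec.Seq)
  next
    case (CondTrue b s c t s' d)
    then have "eval_exp b r = eval_exp b s" "exp_cost b r = exp_cost b s"
      by (intro cong; simp)+
    with CondTrue.prems CondTrue.IH[of r] CondTrue.hyps show ?case
      by (metis exec.CondTrue com_vars.simps(3) le_sup_iff)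
  next
    case (CondFalse b s d t s' c)
    then have "eval_exp b r = eval_exp b s" "exp_cost b r = exp_cost b s"
      by (intro cong; simp)+
    with CondFalse.prems CondFalse.IH[of r] CondFalse.hyps show ?case
      by (metis exec.CondFalse com_vars.simps(3) le_sup_iff)
  next
    case (WhileFalse b s c)
    then have "eval_exp b r = eval_exp b s" "exp_cost b r = exp_cost b s"
      by (intro cong; simp)+
    with WhileFalse show ?case
      by (metis exec.WhileFalse)
  next
    case (WhileTrue b s c t s' u s'')
    then have b: "eval_exp b r = eval_exp b s" "exp_cost b r = exp_cost b s"
      by (intro cong; simp)+
    from WhileTrue.prems WhileTrue.IH(1)[of r] obtain r'
      where r': "exec c r t r'" "\<forall>v\<in>V. r' v = s' v" "\<forall>v. v \<notin> V \<longrightarrow> r' v = r v"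
      by auto
    from WhileTrue.prems WhileTrue.IH(2)[of r'] r' obtain r''
      where "exec (While b c) r' u r''" "\<forall>v\<in>V. r'' v = s'' v" "\<forall>v. v \<notin> V \<longrightarrow> r'' v = r' v"
      by auto
    with r' b WhileTrue.hyps(1) show ?case
      by (metis exec.WhileTrue)
  qed
  then show thesis
    using that by blast
qed

section \<open>Sizes of values and evaluation budgets\<close>

lemma tree_size_pos: "tree_size t > 0"
  by (cases t) auto

lemma tree_size_eval_exp: "tree_size (eval_exp a s) \<le> exp_cost a s"
  by (cases a) auto

text \<open>The cost of an expression includes the size of its value, so each newly written value
  has been paid for. This bounds the output of the black-box program by its input and its running
  time.\<close>

lemma exec_tree_size: "exec c s t s' \<Longrightarrow> tree_size (s' v) \<le> tree_size (s v) + t"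
  by (induction rule: exec.induct) (use tree_size_eval_exp in \<open>auto intro: trans_le_add2\<close>)

text \<open>Costs are counted in multiples of a fixed bound \<open>K\<close> on the cost of every evaluated
  expression, so that \<open>n\<close> is the number of evaluations.\<close>
definition halts :: "nat \<Rightarrow> nat \<Rightarrow> com \<Rightarrow> store \<Rightarrow> (store \<Rightarrow> bool) \<Rightarrow> bool" where
  "halts K n c s Q \<longleftrightarrow> (\<exists>t s'. exec c s t s' \<and> t \<le> n * K \<and> Q s')"

lemma haltsI: "exec c s t s' \<Longrightarrow> t \<le> n * K \<Longrightarrow> Q s' \<Longrightarrow> halts K n c s Q"
  by (auto simp: halts_def)

lemma halts_weaken: "halts K m c s P \<Longrightarrow> m \<le> n \<Longrightarrow> (\<And>s'. P s' \<Longrightarrow> Q s') \<Longrightarrow> halts K n c s Q"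
  unfolding halts_def by (meson le_trans mult_le_mono1)

lemma halts_Assign:
  assumes "exp_cost a s \<le> K" "0 < n" "Q (s(x := eval_exp a s))"
  shows "halts K n (Assign x a) s Q"
proof (rule haltsI[OF exec.Assign])
  have "1 * K \<le> n * K"
    using assms(2) by (intro mult_le_mono1) simp
  with assms(1) show "exp_cost a s \<le> n * K"
    by linarith
qed (fact assms(3))

lemma halts_Seq:
  assumes "halts K m c s P" "\<And>s'. P s' \<Longrightarrow> halts K n d s' Q" "m + n \<le> l"
  shows "halts K l (Seq c d) s Q"
proof -
  obtain t s' where c: "exec c s t s'" "t \<le> m * K" "P s'"
    using assms(1) by (auto simp: halts_def)
  obtain u s'' where d: "exec d s' u s''" "u \<le> n * K" "Q s''"
    using assms(2)[OF c(3)] by (auto simp: halts_def)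
  have "t + u \<le> (m + n) * K"
    using c(2) d(2) by (simp add: distrib_right)
  also have "\<dots> \<le> l * K"
    using assms(3) by (rule mult_le_mono1)
  finally show ?thesis
    using haltsI[where Q = Q, OF exec.Seq[OF c(1) d(1)]] d(3) by blast
qed

text \<open>Stated with the exact updated store, so that straight-line code can be executed
  symbolically by repeated introduction.\<close>

lemma halts_Seq_Assign:
  assumes "exp_cost a s \<le> K" "0 < n" "halts K (n - 1) d (s(x := eval_exp a s)) Q"
  shows "halts K n (Seq (Assign x a) d) s Q"
  by (rule halts_Seq[where m = 1 and n = "n - 1" and P = "\<lambda>s'. s' = s(x := eval_exp a s)"])
    (use assms in \<open>auto intro: halts_Assign\<close>)

lemma halts_Cond:
  assumes "exp_cost b s \<le> K" "0 < n"
    and "eval_exp b s \<noteq> Leaf \<Longrightarrow> halts K (n - 1) c s Q"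
    and "eval_exp b s = Leaf \<Longrightarrow> halts K (n - 1) d s Q"
  shows "halts K n (Cond b c d) s Q"
proof -
  have bound: "exp_cost b s + t \<le> n * K" if "t \<le> (n - 1) * K" for t
    using assms(1,2) that by (cases n) auto
  show ?thesis
  proof (cases "eval_exp b s = Leaf")
    case True
    then obtain t s' where "exec d s t s'" "t \<le> (n - 1) * K" "Q s'"
      using assms(4) by (auto simp: halts_def)
    then show ?thesis
      using exec.CondFalse[OF True] bound by (meson haltsI)
  next
    case False
    then obtain t s' where "exec c s t s'" "t \<le> (n - 1) * K" "Q s'"
      using assms(3) by (auto simp: halts_def)
    then show ?thesis
      using exec.CondTrue[OF False] bound by (meson haltsI)
  qed
qed

text \<open>\<open>P\<close> is indexed by the part of the list still to be processed. Each entry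
  costs \<open>n\<close> for the body and 1 for the guard; the final 1 pays for the failing guard,
  which has positive cost even on \<open>Leaf\<close>.\<close>

lemma halts_list_loop:
  assumes step: "\<And>y ys s. P (y # ys) s \<Longrightarrow> s l \<noteq> Leaf \<and> tree_size (s l) \<le> K \<and> halts K n c s (P ys)"
    and stop: "\<And>s. P [] s \<Longrightarrow> s l = Leaf"
    and K: "0 < K" and start: "P ys s"
  shows "halts K (length ys * (n + 1) + 1) (While (Var l) c) s (P [])"
  using start
proof (induction ys arbitrary: s)
  case Nil
  have "exec (While (Var l) c) s (exp_cost (Var l) s) s"
    by (rule exec.WhileFalse) (simp add: stop[OF Nil])
  then show ?case
    by (rule haltsI) (use stop[OF Nil] K Nil in auto)
next
  case (Cons y ys)
  obtain t s' where t: "exec c s t s'" "t \<le> n * K" "P ys s'"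
    using step[OF Cons.prems] by (auto simp: halts_def)
  obtain u s'' where u: "exec (While (Var l) c) s' u s''" "u \<le> (length ys * (n + 1) + 1) * K" "P [] s''"
    using Cons.IH[OF t(3)] by (auto simp: halts_def)
  have "exec (While (Var l) c) s (exp_cost (Var l) s + t + u) s''"
    by (rule exec.WhileTrue[OF _ t(1) u(1)]) (use step[OF Cons.prems] in simp)
  moreover have "exp_cost (Var l) s \<le> K"
    using step[OF Cons.prems] by simp
  then have "exp_cost (Var l) s + t + u \<le> K + n * K + (length ys * (n + 1) + 1) * K"
    using t(2) u(2) by linarith
  then have "exp_cost (Var l) s + t + u \<le> (length (y # ys) * (n + 1) + 1) * K"
    by (simp add: algebra_simps)
  ultimately show ?case
    using u(3) by (rule haltsI)
qed

section \<open>Tree encodings of lists and numbers\<close>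

lemma enc_list_simps [simp]:
  "enc_list e [] = Leaf" "enc_list e (x # xs) = Node (e x) (enc_list e xs)"
  by (simp_all add: enc_list_def)

lemma length_le_tree_size_enc_list: "length xs \<le> tree_size (enc_list e xs)"
  by (induction xs) auto

text \<open>Programs compare vertices by testing their encodings with \<open>Eq\<close>. A nonzero
  number is recovered from its parity in the head and its half in the tail.\<close>

lemma enc_nat_inject: "enc_nat m = enc_nat n \<longleftrightarrow> m = n"
proof (induction m arbitrary: n rule: less_induct)
  case (less m)
  show ?case
  proof (cases "m = 0 \<or> n = 0")
    case True
    then show ?thesis
      using enc_nat.simps[of m] enc_nat.simps[of n] by (auto split: if_splits)
  next
    case False
    then have "enc_nat m = enc_nat n \<longleftrightarrow> odd m = odd n \<and> m div 2 = n div 2"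
      using less[of "m div 2" "n div 2"] enc_nat.simps[of m] enc_nat.simps[of n] by auto
    also have "\<dots> \<longleftrightarrow> m = n"
      by presburger
    finally show ?thesis .
  qed
qed

abbreviation enc_vertex :: "(nat \<Rightarrow> colour) \<Rightarrow> nat \<Rightarrow> tree" where
  "enc_vertex f \<equiv> \<lambda>v. Node (enc_nat v) (enc_colour (f v))"

abbreviation enc_edge :: "nat \<times> nat \<Rightarrow> tree" where
  "enc_edge \<equiv> \<lambda>(u, v). Node (enc_nat u) (enc_nat v)"

section \<open>The reduction as a WHILE program\<close>

text \<open>Variables: 0 holds the input and later the reduced graph, 2 its vertices, 6 its edges, \<open>k\<close> the
  vertices of colour \<^const>\<open>One\<close>; 7 and 3 are cursors into the vertex and edge lists, and 4 and 5 the
  colours of the endpoints of the current edge.\<close>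
definition split_vertices :: "nat \<Rightarrow> com" where
  "split_vertices k = While (Var 7)
     (Seq (Cond (Tl (Hd (Var 7)))
             (Assign 2 (ConsE (Hd (Hd (Var 7))) (Var 2)))
             (Assign k (ConsE (Hd (Hd (Var 7))) (Var k))))
          (Assign 7 (Tl (Var 7))))"

text \<open>\<open>One\<close> is encoded as \<open>Leaf\<close>, so the colour component of an
  entry serves directly as the test.\<close>

lemma halts_split_vertices:
  assumes k: "8 \<le> k" and K: "10 * N \<le> K"
    and s: "s 7 = enc_list (enc_vertex f) vs" "s 2 = Leaf" "s k = Leaf" "tree_size (s 7) < N"
  shows "halts K (4 * length vs + 1) (split_vertices k) s
    (\<lambda>s'. s' 2 = enc_list enc_nat (rev (filter (\<lambda>v. f v \<noteq> One) vs)) \<and>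
          s' k = enc_list enc_nat (rev (filter (\<lambda>v. f v = One) vs)) \<and>
          tree_size (s' 2) \<le> N \<and> tree_size (s' k) \<le> N \<and>
          (\<forall>v. v \<notin> {2, 7, k} \<longrightarrow> s' v = s v))"
proof -
  \<comment> \<open>An entry pushed onto 2 or \<open>k\<close> is smaller than the one consumed from
    7, so neither size sum grows. The strict bound on the initial size leaves room for the empty
    list, whose size is 1.\<close>
  define P where "P = (\<lambda>ys s'. s' 7 = enc_list (enc_vertex f) ys \<and>
    (\<exists>xs. s' 2 = enc_list enc_nat xs \<and>
       rev (filter (\<lambda>v. f v \<noteq> One) ys) @ xs = rev (filter (\<lambda>v. f v \<noteq> One) vs)) \<and>
    (\<exists>xs. s' k = enc_list enc_nat xs \<and>
       rev (filter (\<lambda>v. f v = One) ys) @ xs = rev (filter (\<lambda>v. f v = One) vs)) \<and>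
    tree_size (s' 7) + tree_size (s' 2) \<le> N \<and> tree_size (s' 7) + tree_size (s' k) \<le> N \<and>
    (\<forall>v. v \<notin> {2, 7, k} \<longrightarrow> s' v = s v))"
  have start: "P vs s"
    using s by (auto simp: P_def)
  have step: "s' 7 \<noteq> Leaf \<and> tree_size (s' 7) \<le> K \<and>
     halts K 3 (Seq (Cond (Tl (Hd (Var 7)))
             (Assign 2 (ConsE (Hd (Hd (Var 7))) (Var 2)))
             (Assign k (ConsE (Hd (Hd (Var 7))) (Var k))))
          (Assign 7 (Tl (Var 7)))) s' (P ys)" if P: "P (y # ys) s'" for y ys s'
  proof (intro conjI)
    have s7: "s' 7 = Node (enc_vertex f y) (enc_list (enc_vertex f) ys)"
      using P by (simp add: P_def)
    then show "s' 7 \<noteq> Leaf"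
      by simp
    have sizes: "tree_size (s' 7) + tree_size (s' 2) \<le> N" "tree_size (s' 7) + tree_size (s' k) \<le> N"
      using P by (auto simp: P_def)
    then show "tree_size (s' 7) \<le> K"
      using K by linarith
    show "halts K 3 (Seq (Cond (Tl (Hd (Var 7)))
             (Assign 2 (ConsE (Hd (Hd (Var 7))) (Var 2)))
             (Assign k (ConsE (Hd (Hd (Var 7))) (Var k))))
          (Assign 7 (Tl (Var 7)))) s' (P ys)"
    proof (rule halts_Seq[where m = 2 and n = 1 and P = "\<lambda>s''. s'' =
        (if f y \<noteq> One then s'(2 := Node (enc_nat y) (s' 2)) else s'(k := Node (enc_nat y) (s' k)))"])
      show "halts K 2 (Cond (Tl (Hd (Var 7)))
             (Assign 2 (ConsE (Hd (Hd (Var 7))) (Var 2)))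
             (Assign k (ConsE (Hd (Hd (Var 7))) (Var k)))) s' (\<lambda>s''. s'' =
        (if f y \<noteq> One then s'(2 := Node (enc_nat y) (s' 2)) else s'(k := Node (enc_nat y) (s' k))))"
        using K sizes s7 by (intro halts_Cond halts_Assign) (cases "f y"; simp)+
    next
      fix s'' assume s'': "s'' =
        (if f y \<noteq> One then s'(2 := Node (enc_nat y) (s' 2)) else s'(k := Node (enc_nat y) (s' k)))"
      have s''7: "s'' 7 = s' 7"
        using k by (simp add: s'')
      show "halts K 1 (Assign 7 (Tl (Var 7))) s'' (P ys)"
      proof (rule halts_Assign)
        show "exp_cost (Tl (Var 7)) s'' \<le> K"
          using K sizes s7 by (simp add: s''7)
        show "P ys (s''(7 := eval_exp (Tl (Var 7)) s''))"
        proof (cases "f y = One")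
          case True
          then show ?thesis
            using P k s7 by (auto simp: P_def s'' intro: exI[of _ "y # _"])
        next
          case False
          then show ?thesis
            using P k s7 by (auto simp: P_def s'' intro: exI[of _ "y # _"])
        qed
      qed simp
    qed simp
  qed
  have pos: "0 < K"
    using K s(4) by linarith
  have "halts K (length vs * (3 + 1) + 1) (split_vertices k) s (P [])"
    unfolding split_vertices_def by (rule halts_list_loop[where P = P, OF _ _ pos start]) (erule step, simp add: P_def)
  then show ?thesis
    by (rule halts_weaken) (auto simp: P_def)
qed

section \<open>Selecting the edges of the reduced graph\<close>

text \<open>The vertex list acts as an association list from vertices to colours.
  \<open>Assign 7 (Var 7)\<close> stands in for a skip command.\<close>

definition lookup_colours :: com where
  "lookup_colours = While (Var 7)
     (Seq (Cond (Eq (Hd (Hd (Var 7))) (Hd (Hd (Var 3))))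
             (Assign 4 (Tl (Hd (Var 7)))) (Assign 7 (Var 7)))
     (Seq (Cond (Eq (Hd (Hd (Var 7))) (Tl (Hd (Var 3))))
             (Assign 5 (Tl (Hd (Var 7)))) (Assign 7 (Var 7)))
          (Assign 7 (Tl (Var 7)))))"

text \<open>The comparisons fix the scale of \<open>K\<close>: they have seven subexpressions, each
  with a value of size at most \<open>N\<close>, and the factor 10 leaves room.\<close>

lemma halts_lookup_colours:
  assumes K: "10 * N \<le> K"
    and s: "s 7 = enc_list (enc_vertex f) vs" "s 3 = Node (enc_edge (u, v)) r"
      "tree_size (s 7) \<le> N" "tree_size (s 3) \<le> N"
    and uv: "u \<in> set vs" "v \<in> set vs"
  shows "halts K (6 * length vs + 1) lookup_colours s
    (\<lambda>s'. s' 4 = enc_colour (f u) \<and> s' 5 = enc_colour (f v) \<and>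
          (\<forall>v. v \<notin> {4, 5, 7} \<longrightarrow> s' v = s v))"
proof -
  \<comment> \<open>Each endpoint either still lies ahead of the cursor or already has its colour
    stored; at the empty list only the second case remains.\<close>
  define P where "P = (\<lambda>ys s'. s' 7 = enc_list (enc_vertex f) ys \<and> tree_size (s' 7) \<le> N \<and>
    (u \<in> set ys \<or> s' 4 = enc_colour (f u)) \<and> (v \<in> set ys \<or> s' 5 = enc_colour (f v)) \<and>
    (\<forall>v. v \<notin> {4, 5, 7} \<longrightarrow> s' v = s v))"
  have start: "P vs s"
    using s uv by (auto simp: P_def)
  have step: "s' 7 \<noteq> Leaf \<and> tree_size (s' 7) \<le> K \<and> halts K 5
     (Seq (Cond (Eq (Hd (Hd (Var 7))) (Hd (Hd (Var 3))))
             (Assign 4 (Tl (Hd (Var 7)))) (Assign 7 (Var 7)))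
     (Seq (Cond (Eq (Hd (Hd (Var 7))) (Tl (Hd (Var 3))))
             (Assign 5 (Tl (Hd (Var 7)))) (Assign 7 (Var 7)))
          (Assign 7 (Tl (Var 7))))) s' (P ys)" if P: "P (y # ys) s'" for y ys s'
  proof (intro conjI)
    have s7: "s' 7 = Node (enc_vertex f y) (enc_list (enc_vertex f) ys)"
      and s3: "s' 3 = Node (enc_edge (u, v)) r"
      using P s(2) by (auto simp: P_def)
    then show "s' 7 \<noteq> Leaf"
      by simp
    have sizes: "tree_size (s' 7) \<le> N" "tree_size (s' 3) \<le> N"
      using P s(4) by (auto simp: P_def)
    then show "tree_size (s' 7) \<le> K"
      using K by linarith
    let ?s1 = "if y = u then s'(4 := enc_colour (f y)) else s'"
    let ?s2 = "if y = v then ?s1(5 := enc_colour (f y)) else ?s1"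
    show "halts K 5
     (Seq (Cond (Eq (Hd (Hd (Var 7))) (Hd (Hd (Var 3))))
             (Assign 4 (Tl (Hd (Var 7)))) (Assign 7 (Var 7)))
     (Seq (Cond (Eq (Hd (Hd (Var 7))) (Tl (Hd (Var 3))))
             (Assign 5 (Tl (Hd (Var 7)))) (Assign 7 (Var 7)))
          (Assign 7 (Tl (Var 7))))) s' (P ys)"
    proof (rule halts_Seq[where m = 2 and n = 3 and P = "\<lambda>s''. s'' = ?s1"])
      show "halts K 2 (Cond (Eq (Hd (Hd (Var 7))) (Hd (Hd (Var 3))))
             (Assign 4 (Tl (Hd (Var 7)))) (Assign 7 (Var 7))) s' (\<lambda>s''. s'' = ?s1)"
        using K sizes s7 s3 by (intro halts_Cond halts_Assign) (auto simp: enc_nat_inject)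
    next
      fix s1 assume s1: "s1 = ?s1"
      have s7': "s1 7 = s' 7" and s3': "s1 3 = s' 3"
        by (auto simp: s1)
      show "halts K 3 (Seq (Cond (Eq (Hd (Hd (Var 7))) (Tl (Hd (Var 3))))
             (Assign 5 (Tl (Hd (Var 7)))) (Assign 7 (Var 7)))
          (Assign 7 (Tl (Var 7)))) s1 (P ys)"
      proof (rule halts_Seq[where m = 2 and n = 1 and P = "\<lambda>s''. s'' = ?s2"])
        show "halts K 2 (Cond (Eq (Hd (Hd (Var 7))) (Tl (Hd (Var 3))))
             (Assign 5 (Tl (Hd (Var 7)))) (Assign 7 (Var 7))) s1 (\<lambda>s''. s'' = ?s2)"
          unfolding s1[symmetric]
          using K sizes s7 s3 s7' s3' by (intro halts_Cond halts_Assign) (auto simp: enc_nat_inject)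
      next
        fix s2 assume s2: "s2 = ?s2"
        have s7'': "s2 7 = s' 7"
          by (simp add: s2)
        show "halts K 1 (Assign 7 (Tl (Var 7))) s2 (P ys)"
        proof (rule halts_Assign)
          show "exp_cost (Tl (Var 7)) s2 \<le> K"
            using K sizes s7 by (simp add: s7'')
          show "P ys (s2(7 := eval_exp (Tl (Var 7)) s2))"
            using P s7 s7'' by (auto simp: P_def s2)
        qed simp
      qed simp
    qed simp
  qed
  have pos: "0 < K"
    using K s(3) tree_size_pos[of "s 7"] by linarith
  have "halts K (length vs * (5 + 1) + 1) lookup_colours s (P [])"
    unfolding lookup_colours_def by (rule halts_list_loop[where P = P, OF _ _ pos start]) (erule step, simp add: P_def)
  then show ?thesis
    by (rule halts_weaken) (auto simp: P_def)
qed

text \<open>The colour condition of \<open>edges_reduced_graph\<close>, read off an oriented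
  pair.\<close>

definition survives :: "(nat \<Rightarrow> colour) \<Rightarrow> nat \<times> nat \<Rightarrow> bool" where
  "survives f = (\<lambda>(u, v). f u \<noteq> One \<and> f v \<noteq> One \<and> (f u = ZeroHat \<or> f v = ZeroHat))"

text \<open>\<open>One\<close> is the only colour encoded as \<open>Leaf\<close>, and
  \<open>ZeroHat\<close> the only one whose encoding has a right part other than
  \<open>Leaf\<close>. Nested tests therefore replace the boolean connectives.\<close>

definition if_survives :: "com \<Rightarrow> com \<Rightarrow> com" where
  "if_survives c d = Cond (Var 4) (Cond (Var 5) (Cond (Tl (Var 4)) c (Cond (Tl (Var 5)) c d)) d) d"

lemma halts_if_survives:
  assumes s: "s 4 = enc_colour (f u)" "s 5 = enc_colour (f v)" and K: "10 \<le> K" and n: "0 < n"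
    and c: "survives f (u, v) \<Longrightarrow> halts K n c s Q"
    and d: "\<not> survives f (u, v) \<Longrightarrow> halts K n d s Q"
  shows "halts K (n + 4) (if_survives c d) s Q"
proof -
  \<comment> \<open>The branches are reached after one to four tests; the slack in \<open>m\<close>
    absorbs the difference.\<close>
  have run: "halts K m c s Q" if "survives f (u, v)" "n \<le> m" for m
    using c[OF that(1)] that(2) by (rule halts_weaken)
  have skip: "halts K m d s Q" if "\<not> survives f (u, v)" "n \<le> m" for m
    using d[OF that(1)] that(2) by (rule halts_weaken)
  have code: "enc_colour x = Leaf \<longleftrightarrow> x = One" "right (enc_colour x) = Leaf \<longleftrightarrow> x \<noteq> ZeroHat" for x
    by (cases x; simp)+
  have sizes: "tree_size (enc_colour x) \<le> 5" "tree_size (right (enc_colour x)) \<le> 5" for x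
    by (cases x; simp)+
  have cost: "exp_cost (Var 4) s \<le> K" "exp_cost (Var 5) s \<le> K"
    "exp_cost (Tl (Var 4)) s \<le> K" "exp_cost (Tl (Var 5)) s \<le> K"
    using sizes[of "f u"] sizes[of "f v"] K by (simp_all add: s)
  show ?thesis
    unfolding if_survives_def
    by (intro halts_Cond cost run skip) (simp_all add: s code survives_def n)
qed

text \<open>Looking up colours consumes the cursor 7, so it is reloaded from the intact input in 0
  for each edge. \<open>Assign 7 NilE\<close> is the idle branch: the content of 7 is no longer
  wanted at that point.\<close>

definition filter_edges :: com where
  "filter_edges = While (Var 3)
     (Seq (Assign 7 (Hd (Var 0)))
     (Seq lookup_colours
     (Seq (if_survives (Assign 6 (ConsE (Hd (Var 3)) (Var 6))) (Assign 7 NilE))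
          (Assign 3 (Tl (Var 3))))))"

lemma halts_filter_edges:
  assumes K: "10 * N \<le> K"
    and s: "s 0 = Node (enc_list (enc_vertex f) vs) b" "tree_size (s 0) \<le> N"
      "s 3 = enc_list enc_edge es" "s 6 = Leaf" "tree_size (s 3) < N"
    and es: "\<And>u v. (u, v) \<in> set es \<Longrightarrow> u \<in> set vs \<and> v \<in> set vs"
  shows "halts K (length es * (6 * length vs + 10) + 1) filter_edges s
    (\<lambda>s'. s' 6 = enc_list enc_edge (rev (filter (survives f) es)) \<and> tree_size (s' 6) \<le> N \<and>
          (\<forall>v. v \<notin> {3, 4, 5, 6, 7} \<longrightarrow> s' v = s v))"
proof -
  \<comment> \<open>Keeping \<open>set ys\<close> inside \<open>set es\<close> guarantees that the
    endpoints of the current edge occur in the vertex list, so that the lookup succeeds.\<close>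
  define P where "P = (\<lambda>ys s'. s' 3 = enc_list enc_edge ys \<and> set ys \<subseteq> set es \<and>
    (\<exists>xs. s' 6 = enc_list enc_edge xs \<and>
       rev (filter (survives f) ys) @ xs = rev (filter (survives f) es)) \<and>
    tree_size (s' 3) + tree_size (s' 6) \<le> N \<and>
    (\<forall>v. v \<notin> {3, 4, 5, 6, 7} \<longrightarrow> s' v = s v))"
  have start: "P es s"
    using s by (auto simp: P_def)
  have step: "s' 3 \<noteq> Leaf \<and> tree_size (s' 3) \<le> K \<and> halts K (6 * length vs + 9)
     (Seq (Assign 7 (Hd (Var 0)))
     (Seq lookup_colours
     (Seq (if_survives (Assign 6 (ConsE (Hd (Var 3)) (Var 6))) (Assign 7 NilE))
          (Assign 3 (Tl (Var 3)))))) s' (P ys)" if P: "P (y # ys) s'" for y ys s'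
  proof (intro conjI)
    obtain u v where y: "y = (u, v)"
      by fastforce
    have s3: "s' 3 = Node (enc_edge (u, v)) (enc_list enc_edge ys)"
      and s0: "s' 0 = Node (enc_list (enc_vertex f) vs) b"
      using P s(1) by (auto simp: P_def y)
    then show "s' 3 \<noteq> Leaf"
      by simp
    have sizes: "tree_size (s' 3) + tree_size (s' 6) \<le> N" "tree_size (s' 0) \<le> N"
      using P s(2) by (auto simp: P_def)
    then show "tree_size (s' 3) \<le> K"
      using K by linarith
    have uv: "u \<in> set vs" "v \<in> set vs"
      using P es by (auto simp: P_def y)
    let ?s1 = "s'(7 := enc_list (enc_vertex f) vs)"
    show "halts K (6 * length vs + 9) (Seq (Assign 7 (Hd (Var 0)))
     (Seq lookup_colours
     (Seq (if_survives (Assign 6 (ConsE (Hd (Var 3)) (Var 6))) (Assign 7 NilE))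
          (Assign 3 (Tl (Var 3)))))) s' (P ys)"
    proof (rule halts_Seq_Assign)
      show "exp_cost (Hd (Var 0)) s' \<le> K"
        using sizes K s0 by simp
      have "halts K (6 * length vs + 8) (Seq lookup_colours
     (Seq (if_survives (Assign 6 (ConsE (Hd (Var 3)) (Var 6))) (Assign 7 NilE))
          (Assign 3 (Tl (Var 3))))) ?s1 (P ys)"
      proof (rule halts_Seq[where n = 7])
        show "halts K (6 * length vs + 1) lookup_colours ?s1
          (\<lambda>s2. s2 4 = enc_colour (f u) \<and> s2 5 = enc_colour (f v) \<and>
            (\<forall>v. v \<notin> {4, 5, 7} \<longrightarrow> s2 v = ?s1 v))"
          by (rule halts_lookup_colours[OF K]) (use s3 s0 sizes uv in auto)
      next
        fix s2
        assume s2: "s2 4 = enc_colour (f u) \<and> s2 5 = enc_colour (f v) \<and>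
            (\<forall>v. v \<notin> {4, 5, 7} \<longrightarrow> s2 v = ?s1 v)"
        have s2': "s2 3 = s' 3" "s2 6 = s' 6"
          using s2 by auto
        let ?R = "\<lambda>s3. s3 3 = s' 3 \<and> (\<forall>v. v \<notin> {3, 4, 5, 6, 7} \<longrightarrow> s3 v = s' v) \<and>
          s3 6 = (if survives f (u, v) then Node (enc_edge (u, v)) (s' 6) else s' 6)"
        show "halts K 7
     (Seq (if_survives (Assign 6 (ConsE (Hd (Var 3)) (Var 6))) (Assign 7 NilE))
          (Assign 3 (Tl (Var 3)))) s2 (P ys)"
        proof (rule halts_Seq[where m = "1 + 4" and n = 1 and P = ?R])
          show "halts K (1 + 4) (if_survives (Assign 6 (ConsE (Hd (Var 3)) (Var 6))) (Assign 7 NilE)) s2 ?R"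
          proof (rule halts_if_survives[where f = f and u = u and v = v])
            show "halts K 1 (Assign 6 (ConsE (Hd (Var 3)) (Var 6))) s2 ?R" if "survives f (u, v)"
              using that s2 s2' s3 sizes K by (intro halts_Assign) auto
            show "halts K 1 (Assign 7 NilE) s2 ?R" if "\<not> survives f (u, v)"
              using that s2 s2' s3 sizes K by (intro halts_Assign) auto
          qed (use s2 K sizes s3 in auto)
        next
          fix s4 assume s4: "?R s4"
          show "halts K 1 (Assign 3 (Tl (Var 3))) s4 (P ys)"
          proof (rule halts_Assign)
            show "exp_cost (Tl (Var 3)) s4 \<le> K"
              using s4 s3 sizes K by simp
            obtain xs where xs: "s' 6 = enc_list enc_edge xs"
                "rev (filter (survives f) (y # ys)) @ xs = rev (filter (survives f) es)"
              using P by (auto simp: P_def)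
            have "\<exists>xs. s4 6 = enc_list enc_edge xs \<and>
                rev (filter (survives f) ys) @ xs = rev (filter (survives f) es)"
              using xs s4
              by (intro exI[of _ "if survives f (u, v) then (u, v) # xs else xs"]) (auto simp: y split: if_splits)
            then show "P ys (s4(3 := eval_exp (Tl (Var 3)) s4))"
              using P s4 s3 by (auto simp: P_def y)
          qed simp
        qed simp
      qed simp
      then show "halts K (6 * length vs + 9 - 1) (Seq lookup_colours
     (Seq (if_survives (Assign 6 (ConsE (Hd (Var 3)) (Var 6))) (Assign 7 NilE))
          (Assign 3 (Tl (Var 3))))) (s'(7 := eval_exp (Hd (Var 0)) s')) (P ys)"
        using s0 by (simp add: add.commute)
    qed simp
  qed
  have pos: "0 < K"
    using K s(5) by linarith
  have "halts K (length es * (6 * length vs + 9 + 1) + 1) filter_edges s (P [])"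
    unfolding filter_edges_def by (rule halts_list_loop[where P = P, OF _ _ pos start]) (erule step, simp add: P_def)
  then show ?thesis
    by (rule halts_weaken) (auto simp: P_def)
qed

section \<open>The complete reduction\<close>

text \<open>Variable 0 is overwritten only after the edges are filtered. The closing
  \<open>NilE\<close> assignments restore the initial store below \<open>k\<close>, as the next
  program expects it.\<close>

definition reduce :: "nat \<Rightarrow> com" where
  "reduce k =
     Seq (Assign 7 (Hd (Var 0)))
    (Seq (split_vertices k)
    (Seq (Assign 3 (Tl (Var 0)))
    (Seq filter_edges
    (Seq (Assign 0 (ConsE (Var 2) (Var 6)))
    (Seq (Assign 2 NilE) (Seq (Assign 4 NilE) (Seq (Assign 5 NilE)
    (Seq (Assign 6 NilE) (Seq (Assign 7 NilE) (Assign 3 NilE))))))))))"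

lemma halts_reduce:
  fixes vs :: "nat list" and es :: "(nat \<times> nat) list" and f :: "nat \<Rightarrow> colour"
  defines "x \<equiv> Node (enc_list (enc_vertex f) vs) (enc_list enc_edge es)"
    and "y \<equiv> Node (enc_list enc_nat (rev (filter (\<lambda>v. f v \<noteq> One) vs)))
                 (enc_list enc_edge (rev (filter (survives f) es)))"
  defines "N \<equiv> tree_size x"
  assumes k: "8 \<le> k" and es: "\<And>u v. (u, v) \<in> set es \<Longrightarrow> u \<in> set vs \<and> v \<in> set vs"
  shows "halts (10 * N) (30 * (N + 1)\<^sup>2) (reduce k) (init_store x)
    (\<lambda>s. (\<forall>v<k. s v = init_store y v) \<and> tree_size y \<le> 3 * N \<and>
         s k = enc_list enc_nat (rev (filter (\<lambda>v. f v = One) vs)) \<and> tree_size (s k) \<le> N)"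
proof -
  let ?K = "10 * N" and ?V = "enc_list (enc_vertex f) vs" and ?E = "enc_list enc_edge es"
  let ?tail = "Seq (Assign 0 (ConsE (Var 2) (Var 6)))
    (Seq (Assign 2 NilE) (Seq (Assign 4 NilE) (Seq (Assign 5 NilE)
    (Seq (Assign 6 NilE) (Seq (Assign 7 NilE) (Assign 3 NilE))))))"
  let ?Q = "\<lambda>s. (\<forall>v<k. s v = init_store y v) \<and> tree_size y \<le> 3 * N \<and>
         s k = enc_list enc_nat (rev (filter (\<lambda>v. f v = One) vs)) \<and> tree_size (s k) \<le> N"
  have V: "tree_size ?V < N" and E: "tree_size ?E < N"
    by (auto simp: N_def x_def)
  define R where "R = (\<lambda>s :: store. (\<forall>v. v \<notin> {2, 7, k} \<longrightarrow> s v = init_store x v) \<and>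
    s 2 = enc_list enc_nat (rev (filter (\<lambda>v. f v \<noteq> One) vs)) \<and>
    s k = enc_list enc_nat (rev (filter (\<lambda>v. f v = One) vs)) \<and>
    tree_size (s 2) \<le> N \<and> tree_size (s k) \<le> N)"
  \<comment> \<open>The budgets of the two loops. The 9 added later pays for loading the two cursors
    and for the seven assignments of \<open>?tail\<close>.\<close>
  define a b where "a = 4 * length vs + 1" and "b = length es * (6 * length vs + 10) + 1"
  have tail: "halts ?K 7 ?tail s ?Q"
    if s: "\<forall>v. v \<notin> {2, 3, 4, 5, 6, 7, k} \<longrightarrow> s v = init_store x v"
      "s 2 = enc_list enc_nat (rev (filter (\<lambda>v. f v \<noteq> One) vs))"
      "s k = enc_list enc_nat (rev (filter (\<lambda>v. f v = One) vs))"
      "s 6 = enc_list enc_edge (rev (filter (survives f) es))"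
      "tree_size (s 2) \<le> N" "tree_size (s k) \<le> N" "tree_size (s 6) \<le> N" for s
  proof -
    have "Node (s 2) (s 6) = y"
      by (simp add: y_def s)
    \<comment> \<open>Both components have size at most \<open>N\<close>, which gives the bound
      \<open>3 * N\<close> on the reduced instance.\<close>
    then have y: "tree_size y = 1 + tree_size (s 2) + tree_size (s 6)"
      by auto
    show ?thesis
      by (intro halts_Seq_Assign halts_Assign)
        (use s k V y \<open>Node (s 2) (s 6) = y\<close> in \<open>auto simp: init_store_def\<close>)
  qed
  have filter_tail: "halts ?K (b + 8) (Seq (Assign 3 (Tl (Var 0))) (Seq filter_edges ?tail)) s ?Q"
    if R: "R s" for s
  proof (rule halts_Seq_Assign)
    have s0: "s 0 = x"
      using R k by (auto simp: R_def init_store_def)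
    then show "exp_cost (Tl (Var 0)) s \<le> ?K"
      using E by (simp add: N_def x_def)
    let ?s = "s(3 := ?E)"
    have "halts ?K (b + 7) (Seq filter_edges ?tail) ?s ?Q"
    proof (rule halts_Seq[where m = b and n = 7])
      show "halts ?K b filter_edges ?s
        (\<lambda>s'. s' 6 = enc_list enc_edge (rev (filter (survives f) es)) \<and> tree_size (s' 6) \<le> N \<and>
          (\<forall>v. v \<notin> {3, 4, 5, 6, 7} \<longrightarrow> s' v = ?s v))"
        unfolding b_def
      proof (rule halts_filter_edges)
        show "?s 0 = Node ?V ?E"
          using s0 by (simp add: x_def)
      qed (use s0 E R k es in \<open>auto simp: N_def R_def init_store_def\<close>)
    next
      fix s'
      assume s': "s' 6 = enc_list enc_edge (rev (filter (survives f) es)) \<and> tree_size (s' 6) \<le> N \<and>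
          (\<forall>v. v \<notin> {3, 4, 5, 6, 7} \<longrightarrow> s' v = ?s v)"
      have "s' 2 = s 2" "s' k = s k"
        using s' k by auto
      with s' R show "halts ?K 7 ?tail s' ?Q"
        by (intro tail) (auto simp: R_def)
    qed simp
    then show "halts ?K (b + 8 - 1) (Seq filter_edges ?tail) (s(3 := eval_exp (Tl (Var 0)) s)) ?Q"
      using s0 by (simp add: x_def add.commute)
  qed simp
  have "halts ?K (a + b + 9) (reduce k) (init_store x) ?Q"
    unfolding reduce_def
  proof (rule halts_Seq_Assign)
    show "exp_cost (Hd (Var 0)) (init_store x) \<le> ?K"
      using V by (simp add: init_store_def N_def x_def)
    let ?s = "(init_store x)(7 := ?V)"
    have "halts ?K (a + (b + 8)) (Seq (split_vertices k)
        (Seq (Assign 3 (Tl (Var 0))) (Seq filter_edges ?tail))) ?s ?Q"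
    proof (rule halts_Seq[where P = R])
      show "halts ?K a (split_vertices k) ?s R"
        unfolding a_def
        by (rule halts_weaken[OF halts_split_vertices[OF k, where N = N and f = f and vs = vs]])
          (use k V in \<open>auto simp: R_def init_store_def\<close>)
    qed (use filter_tail in auto)
    then show "halts ?K (a + b + 9 - 1) (Seq (split_vertices k)
        (Seq (Assign 3 (Tl (Var 0))) (Seq filter_edges ?tail)))
        ((init_store x)(7 := eval_exp (Hd (Var 0)) (init_store x))) ?Q"
      by (simp add: init_store_def x_def ac_simps)
  qed simp
  then show ?thesis
  proof (rule halts_weaken)
    have "length vs \<le> N" "length es \<le> N"
      using V E length_le_tree_size_enc_list[of vs "enc_vertex f"]
        length_le_tree_size_enc_list[of es enc_edge] by linarith+
    then have "length es * (6 * length vs + 10) \<le> N * (6 * N + 10)"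
      by (intro mult_le_mono) auto
    then have "a + b + 9 \<le> 4 * N + N * (6 * N + 10) + 11"
      using \<open>length vs \<le> N\<close> by (simp add: a_def b_def)
    also have "\<dots> \<le> 30 * (N + 1)\<^sup>2"
      by (simp add: power2_eq_square algebra_simps)
    finally show "a + b + 9 \<le> 30 * (N + 1)\<^sup>2" .
  qed
qed

section \<open>Joining the parked list to the cover\<close>

definition append_list :: "nat \<Rightarrow> com" where
  "append_list k = While (Var k)
     (Seq (Assign 0 (ConsE (Hd (Var k)) (Var 0))) (Assign k (Tl (Var k))))"

text \<open>Each iteration moves one list cell from \<open>k\<close> to 0, so the sum of the two
  sizes stays constant.\<close>

lemma halts_append_list:
  assumes k: "0 < k" and K: "10 * M \<le> K"
    and s: "s 0 = enc_list e xs" "s k = enc_list e ys" "tree_size (s 0) + tree_size (s k) \<le> M"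
  shows "halts K (3 * length ys + 1) (append_list k) s (\<lambda>s'. s' 0 = enc_list e (rev ys @ xs))"
proof -
  define P where "P = (\<lambda>zs s'. s' k = enc_list e zs \<and>
    (\<exists>ws. s' 0 = enc_list e ws \<and> rev zs @ ws = rev ys @ xs) \<and>
    tree_size (s' 0) + tree_size (s' k) \<le> M)"
  have start: "P ys s"
    using s by (auto simp: P_def)
  have step: "s' k \<noteq> Leaf \<and> tree_size (s' k) \<le> K \<and> halts K 2
     (Seq (Assign 0 (ConsE (Hd (Var k)) (Var 0))) (Assign k (Tl (Var k)))) s' (P zs)"
    if P: "P (z # zs) s'" for z zs s'
  proof -
    have sk: "s' k = Node (e z) (enc_list e zs)" and M: "tree_size (s' 0) + tree_size (s' k) \<le> M"
      using P by (auto simp: P_def)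
    show ?thesis
      using k K sk M P
      by (intro conjI halts_Seq_Assign halts_Assign) (auto simp: P_def intro: exI[of _ "z # _"])
  qed
  have pos: "0 < K"
    using K s(3) tree_size_pos[of "s 0"] by linarith
  have "halts K (length ys * (2 + 1) + 1) (append_list k) s (P [])"
    unfolding append_list_def by (rule halts_list_loop[where P = P, OF _ _ pos start]) (erule step, simp add: P_def)
  then show ?thesis
    by (rule halts_weaken) (auto simp: P_def)
qed

section \<open>Polynomial bounds and transfer of solvability\<close>

text \<open>Coefficients in \<open>nat\<close> are nonnegative. The bound of the black-box program
  may thus be evaluated at an upper bound of its input size.\<close>

lemma poly_nat_mono: "m \<le> n \<Longrightarrow> poly p m \<le> poly p (n :: nat)"
  by (induction p) (simp_all add: mult_le_mono)

text \<open>\<open>survives\<close> is symmetric in the two endpoints, so the orientation in which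
  an edge happens to be listed does not matter.\<close>

lemma encodes_edges_filter:
  assumes "distinct (map (\<lambda>(u, v). {u, v}) es)" "set (map (\<lambda>(u, v). {u, v}) es) = edges G"
    and "simple_graph G"
  shows "encodes_edges (edges (reduced_graph G f)) (enc_list enc_edge (rev (filter (survives f) es)))"
proof -
  let ?mk = "\<lambda>(u, v). {u, v}"
  let ?es = "rev (filter (survives f) es)"
  have "distinct (map ?mk ?es)"
    using distinct_map_filter[OF assms(1)] by (simp add: rev_map[symmetric])
  moreover have "set (map ?mk ?es) = edges (reduced_graph G f)"
  proof (intro equalityI subsetI)
    fix e assume "e \<in> set (map ?mk ?es)"
    then obtain u v where "e = {u, v}" "(u, v) \<in> set es" "survives f (u, v)"
      by auto
    moreover from this have "e \<in> edges G"
      using assms(2) by force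
    ultimately show "e \<in> edges (reduced_graph G f)"
      using edges_reduced_graph[OF assms(3), of u v f] by (simp add: survives_def)
  next
    fix e assume e: "e \<in> edges (reduced_graph G f)"
    then have "e \<in> set (map ?mk es)"
      unfolding assms(2) by (simp add: reduced_graph_def del_edges_def del_verts_def)
    then obtain u v where uv: "e = {u, v}" "(u, v) \<in> set es"
      by auto
    then have "survives f (u, v)"
      using e edges_reduced_graph[OF assms(3), of u v f] by (simp add: survives_def)
    with uv show "e \<in> set (map ?mk ?es)"
      by force
  qed
  ultimately show ?thesis
    unfolding encodes_edges_def by blast
qed

lemma poly_time_respecting_sds:
  fixes C :: "(nat ugraph \<times> (nat \<Rightarrow> colour)) set"
  assumes C: "\<And>G f. (G, f) \<in> C \<Longrightarrow> two_connected G"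
    and solvable: "poly_time_solvable {reduced_graph G f | G f. (G, f) \<in> C}
      encodes_graph minimum_vertex_cover encodes_set"
  shows "poly_time_solvable C encodes_coloured_graph (\<lambda>(G, f). minimum_respecting_sds G f) encodes_set"
proof -
  obtain c p where "\<forall>H\<in>{reduced_graph G f | G f. (G, f) \<in> C}. \<forall>y. encodes_graph H y \<longrightarrow>
      (\<exists>t s'. exec c (init_store y) t s' \<and> t \<le> poly p (tree_size y) \<and>
        (\<exists>S. minimum_vertex_cover H S \<and> encodes_set S (s' 0)))"
    using solvable unfolding poly_time_solvable_def by (elim exE) rule
  then have c: "\<And>G f y. (G, f) \<in> C \<Longrightarrow> encodes_graph (reduced_graph G f) y \<Longrightarrow>
      \<exists>t s'. exec c (init_store y) t s' \<and> t \<le> poly p (tree_size y) \<and>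
        (\<exists>S. minimum_vertex_cover (reduced_graph G f) S \<and> encodes_set S (s' 0))"
    by fast
  \<comment> \<open>\<open>k\<close> depends on the program \<open>c\<close> alone, not on the
    instance, so a single program serves all inputs. Including 7 keeps \<open>k\<close> clear of the
    working variables.\<close>
  define k where "k = Suc (Max (insert 7 (com_vars c)))"
  have k: "8 \<le> k" and k_fresh: "com_vars c \<subseteq> {..<k}"
    using finite_com_vars[of c] by (auto simp: k_def less_Suc_eq_le)
  define prog where "prog = Seq (reduce k) (Seq c (append_list k))"
  \<comment> \<open>The summands of \<open>q\<close> bound the times of \<open>reduce k\<close>,
    \<open>c\<close> and \<open>append_list k\<close>. The argument of \<open>p\<close> is tripled
    because the reduced instance has size at most three times the input. In the last summand,
    \<open>4 * X + r\<close> bounds the combined size of the output of \<open>c\<close> (at most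
    \<open>3 * X + r\<close>) and of the parked list (at most \<open>X\<close>).\<close>
  define X r q where "X = [:0, 1 :: nat:]" and "r = pcompose p [:0, 3:]"
    and "q = 30 * (X + 1)\<^sup>2 * (10 * X) + r + (3 * X + 1) * (10 * (4 * X + r))"
  have poly_X: "poly X n = n" for n
    by (simp add: X_def)
  have poly_r: "poly r n = poly p (3 * n)" for n
    by (simp add: r_def poly_pcompose mult.commute)
  have poly_q: "poly q n = 30 * (n + 1)\<^sup>2 * (10 * n) + poly p (3 * n) +
      (3 * n + 1) * (10 * (4 * n + poly p (3 * n)))" for n
    by (simp only: q_def poly_add poly_mult poly_power poly_numeral poly_1 poly_X poly_r)
  have "\<exists>t s'. exec prog (init_store x) t s' \<and> t \<le> poly q (tree_size x) \<and>
      (\<exists>S. minimum_respecting_sds G f S \<and> encodes_set S (s' 0))"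
    if Gf: "(G, f) \<in> C" and x: "encodes_coloured_graph (G, f) x" for G f x
  proof -
    let ?N = "tree_size x"
    have G: "two_connected G" and simple: "simple_graph G"
      using C[OF Gf] by (auto simp: two_connected_def)
    obtain vs es where x_eq: "x = Node (enc_list (enc_vertex f) vs) (enc_list enc_edge es)"
      and vs: "distinct vs" "set vs = verts G"
      and es: "distinct (map (\<lambda>(u, v). {u, v}) es)" "set (map (\<lambda>(u, v). {u, v}) es) = edges G"
      using x by (auto simp: encodes_coloured_graph_def encodes_edges_def)
    define ones where "ones = rev (filter (\<lambda>v. f v = One) vs)"
    define y where "y = Node (enc_list enc_nat (rev (filter (\<lambda>v. f v \<noteq> One) vs)))
                 (enc_list enc_edge (rev (filter (survives f) es)))"
    have es_vs: "u \<in> set vs \<and> v \<in> set vs" if "(u, v) \<in> set es" for u v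
    proof -
      have "{u, v} \<in> edges G"
        using that unfolding es(2)[symmetric] by force
      then show ?thesis
        using simple_graph_edge_verts[OF simple] vs(2) by simp
    qed
    have "halts (10 * ?N) (30 * (?N + 1)\<^sup>2) (reduce k) (init_store x)
        (\<lambda>s. (\<forall>v<k. s v = init_store y v) \<and> tree_size y \<le> 3 * ?N \<and>
           s k = enc_list enc_nat ones \<and> tree_size (s k) \<le> ?N)"
      unfolding x_eq y_def ones_def by (rule halts_reduce[OF k es_vs])
    then obtain t1 s1 where s1: "exec (reduce k) (init_store x) t1 s1" "t1 \<le> 30 * (?N + 1)\<^sup>2 * (10 * ?N)"
      "\<forall>v<k. s1 v = init_store y v" "tree_size y \<le> 3 * ?N"
      "s1 k = enc_list enc_nat ones" "tree_size (s1 k) \<le> ?N"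
      unfolding halts_def by blast
    have "encodes_set (verts (reduced_graph G f)) (enc_list enc_nat (rev (filter (\<lambda>v. f v \<noteq> One) vs)))"
      unfolding encodes_set_def
      by (rule exI[of _ "rev (filter (\<lambda>v. f v \<noteq> One) vs)"]) (use vs in \<open>auto simp: verts_reduced_graph\<close>)
    then have "encodes_graph (reduced_graph G f) y"
      using encodes_edges_filter[OF es simple] by (auto simp: encodes_graph_def y_def)
    from c[OF Gf this] obtain t2 s2 S where s2: "exec c (init_store y) t2 s2" "t2 \<le> poly p (tree_size y)"
      and S: "minimum_vertex_cover (reduced_graph G f) S" "encodes_set S (s2 0)"
      by blast
    \<comment> \<open>The run of \<open>c\<close> from \<open>init_store y\<close> is carried over
      to \<open>s1\<close>, which agrees with it below \<open>k\<close>; the parked list in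
      \<open>k\<close> lies outside the frame and survives.\<close>
    obtain s3 where s3: "exec c s1 t2 s3" "s3 0 = s2 0" "s3 k = s1 k"
      using exec_frame[OF s2(1) k_fresh, of s1] s1(3) k by (metis lessThan_iff less_irrefl zero_less_numeral less_le_trans)
    obtain ws where ws: "distinct ws" "set ws = S" "s2 0 = enc_list enc_nat ws"
      using S(2) by (auto simp: encodes_set_def)
    have t2: "t2 \<le> poly p (3 * ?N)"
      using s2(2) poly_nat_mono[OF s1(4)] by (rule le_trans)
    have "tree_size (s3 0) \<le> tree_size (init_store y 0) + t2"
      using exec_tree_size[OF s2(1), of 0] s3(2) by simp
    then have size3: "tree_size (s3 0) + tree_size (s3 k) \<le> 4 * ?N + poly p (3 * ?N)"
      using s1(4,6) s3(3) t2 by (simp add: init_store_def)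
    have "halts (10 * (4 * ?N + poly p (3 * ?N))) (3 * length ones + 1) (append_list k) s3
        (\<lambda>s'. s' 0 = enc_list enc_nat (rev ones @ ws))"
      by (rule halts_append_list[OF _ le_refl _ _ size3]) (use k s3 s1(5) ws(3) in auto)
    then obtain t3 s4 where s4: "exec (append_list k) s3 t3 s4"
      "t3 \<le> (3 * length ones + 1) * (10 * (4 * ?N + poly p (3 * ?N)))"
      "s4 0 = enc_list enc_nat (rev ones @ ws)"
      by (auto simp: halts_def)
    have "length ones \<le> ?N"
      using length_le_tree_size_enc_list[of ones enc_nat] s1(5,6) by simp
    then have "t3 \<le> (3 * ?N + 1) * (10 * (4 * ?N + poly p (3 * ?N)))"
      using s4(2) by (elim le_trans) (intro mult_le_mono1, simp)
    then have "t1 + (t2 + t3) \<le> poly q ?N"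
      using s1(2) t2 unfolding poly_q by linarith
    moreover have "exec prog (init_store x) (t1 + (t2 + t3)) s4"
      unfolding prog_def by (rule exec.Seq[OF s1(1) exec.Seq[OF s3(1) s4(1)]])
    moreover have "set ones = colour_class G f One" "distinct ones"
      using vs by (auto simp: ones_def colour_class_def)
    \<comment> \<open>Disjointness keeps the concatenated list free of repetitions, as
      \<open>encodes_set\<close> demands.\<close>
    moreover have "S \<inter> colour_class G f One = {}"
      using S(1) by (auto simp: minimum_vertex_cover_def vertex_cover_def verts_reduced_graph colour_class_def)
    ultimately have "encodes_set (S \<union> colour_class G f One) (s4 0)"
      unfolding encodes_set_def s4(3)
      by (intro exI[of _ "rev ones @ ws"]) (use ws in auto)
    then show ?thesis
      using minimum_respecting_sds_reduced[OF G S(1)] \<open>t1 + (t2 + t3) \<le> poly q ?N\<close>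
        \<open>exec prog (init_store x) (t1 + (t2 + t3)) s4\<close> by blast
  qed
  then show ?thesis
    unfolding poly_time_solvable_def by (intro exI[of _ prog] exI[of _ q]) auto
qed

theorem theorem11:
  shows "(\<forall>(G :: 'a ugraph) (f :: 'a \<Rightarrow> colour) (S :: 'a set).
            two_connected G \<longrightarrow> minimum_vertex_cover (reduced_graph G f) S \<longrightarrow>
            minimum_respecting_sds G f (S \<union> colour_class G f One))
       \<and> (\<forall>C :: (nat ugraph \<times> (nat \<Rightarrow> colour)) set.
            (\<forall>(G, f)\<in>C. two_connected G) \<longrightarrow>
            poly_time_solvable {reduced_graph G f | G f. (G, f) \<in> C}
              encodes_graph minimum_vertex_cover encodes_set \<longrightarrow>
            poly_time_solvable C
              encodes_coloured_graph (\<lambda>(G, f). minimum_respecting_sds G f) encodes_set)"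
proof (intro conjI allI impI)
  show "minimum_respecting_sds G f (S \<union> colour_class G f One)"
    if "two_connected G" "minimum_vertex_cover (reduced_graph G f) S"
    for G :: "'a ugraph" and f S
    using that by (rule minimum_respecting_sds_reduced)
  show "poly_time_solvable C
      encodes_coloured_graph (\<lambda>(G, f). minimum_respecting_sds G f) encodes_set"
    if "\<forall>(G, f)\<in>C. two_connected G" "poly_time_solvable {reduced_graph G f | G f. (G, f) \<in> C}
      encodes_graph minimum_vertex_cover encodes_set" for C
    by (rule poly_time_respecting_sds) (use that in auto)
qed

end
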